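(* For numerical fluxes depending on three or more points, neither of the E flux and the monotone flux properties implies the other in general. That is: (i) there exist a flux function $f$ and a numerical flux consistent with $f$, depending on at least three points, which is an E flux but is not a monotone flux; (ii) there exist a flux function $f$ and a numerical flux consistent with $f$, depending on at least three points, which is a monotone flux but is not an E flux.
   Context: Consider the scalar conservation law $u_t+f(u)_x=0$ with flux function $f:\mathbb{R}\to\mathbb{R}$ (continuously differentiable). A numerical flux consistent with $f$ is a Lipschitz continuous function $\hat f:\mathbb{R}^{2k}\to\mathbb{R}$, $k\ge1$, used as $\hat f_{j+1/2}=\hat f(u_{j-k+1},\dots,u_{j+k})$, such that $\hat f(u,\dots,u)=f(u)$ for all $u\in\mathbb{R}$. It depends on at least three points if it genuinely depends on at least three of its $2k$ variables (i.e. it is not constant in each of at least three of them), so $k\ge 2$. E flux: for all real values of the arguments $u_{j-k+1},\dots,u_{j+k}$ and every $u$ between $u_j$ and $u_{j+1}$, one has $\operatorname{sgn}(u_{j+1}-u_j)\,(\hat f_{j+1/2}-f(u))\le 0$, where $\operatorname{sgn}(0)=0$. Monotone flux: for some $\sigma>0$ the associated fully discrete explicit scheme $$u_j^{n+1}=u_j^n-\sigma(\hat f^n_{j+1/2}-\hat f^n_{j-1/2})=:H(u^n_{j-k},\dots,u^n_{j+k})$$ is monotone, i.e. $H$ is non-decreasing in each of its arguments. (So a flux is not monotone if the scheme is not monotone for any $\sigma>0$.) *)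

theory Defs
  imports "HOL-Analysis.Analysis"
begin

text \<open>
  A numerical flux in the \<open>2 * k\<close> variables \<open>u\<^sub>j\<^sub>-\<^sub>k\<^sub>+\<^sub>1, \<dots>, u\<^sub>j\<^sub>+\<^sub>k\<close> is modelled as a function
  \<open>F :: (int \<Rightarrow> real) \<Rightarrow> real\<close>, where coordinate \<open>i\<close> of its argument is the value at the grid
  point \<open>j + i\<close>; the genuine variables are those with index in \<open>stencil k\<close>.
  Hence \<open>v 0\<close> and \<open>v 1\<close> stand for \<open>u\<^sub>j\<close> and \<open>u\<^sub>j\<^sub>+\<^sub>1\<close>.
\<close>

definition stencil :: "nat \<Rightarrow> int set" where
  "stencil k = {1 - int k..int k}"

text \<open>
  Lipschitz continuity on \<open>\<real>\<^sup>2\<^sup>k\<close> with the Euclidean norm.  As only coordinates in \<open>stencil k\<close>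
  contribute to the right-hand side, it forces \<open>F\<close> to ignore all other coordinates, so such an
  \<open>F\<close> is exactly a Lipschitz function of \<open>2 * k\<close> real variables.
\<close>

definition lipschitz_flux :: "nat \<Rightarrow> ((int \<Rightarrow> real) \<Rightarrow> real) \<Rightarrow> bool" where
  "lipschitz_flux k F \<longleftrightarrow>
     (\<exists>L\<ge>0. \<forall>v w. \<bar>F v - F w\<bar> \<le> L * L2_set (\<lambda>i. v i - w i) (stencil k))"

definition consistent_flux :: "nat \<Rightarrow> (real \<Rightarrow> real) \<Rightarrow> ((int \<Rightarrow> real) \<Rightarrow> real) \<Rightarrow> bool" where
  "consistent_flux k f F \<longleftrightarrow> k \<ge> 1 \<and> lipschitz_flux k F \<and> (\<forall>u. F (\<lambda>_. u) = f u)"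

definition depends_on_coord :: "((int \<Rightarrow> real) \<Rightarrow> real) \<Rightarrow> int \<Rightarrow> bool" where
  "depends_on_coord F i \<longleftrightarrow> (\<exists>v s t. F (v(i := s)) \<noteq> F (v(i := t)))"

definition at_least_three_points :: "nat \<Rightarrow> ((int \<Rightarrow> real) \<Rightarrow> real) \<Rightarrow> bool" where
  "at_least_three_points k F \<longleftrightarrow> card {i \<in> stencil k. depends_on_coord F i} \<ge> 3"

definition E_flux :: "(real \<Rightarrow> real) \<Rightarrow> ((int \<Rightarrow> real) \<Rightarrow> real) \<Rightarrow> bool" where
  "E_flux f F \<longleftrightarrow>
     (\<forall>v. \<forall>u\<in>closed_segment (v 0) (v 1). sgn (v 1 - v 0) * (F v - f u) \<le> 0)"

text \<open>
  The update map \<open>H(u\<^sub>j\<^sub>-\<^sub>k, \<dots>, u\<^sub>j\<^sub>+\<^sub>k)\<close> of the explicit scheme.  The flux at \<open>j - 1/2\<close> is \<open>F\<close>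
  applied to the grid values shifted by one cell.
\<close>

definition scheme :: "((int \<Rightarrow> real) \<Rightarrow> real) \<Rightarrow> real \<Rightarrow> (int \<Rightarrow> real) \<Rightarrow> real" where
  "scheme F \<sigma> v = v 0 - \<sigma> * (F v - F (\<lambda>i. v (i - 1)))"

definition monotone_flux :: "nat \<Rightarrow> ((int \<Rightarrow> real) \<Rightarrow> real) \<Rightarrow> bool" where
  "monotone_flux k F \<longleftrightarrow>
     (\<exists>\<sigma>>0. \<forall>i\<in>{- int k..int k}. \<forall>v. mono (\<lambda>s. scheme F \<sigma> (v(i := s))))"

end

theory Submission
  imports Defs
begin

text \<open>
  Both counterexamples use the grid points \<open>j - 1, \<dots>, j + 2\<close>, that is \<open>k = 2\<close>, and rest on one
  observation: the E condition controls only the sign of \<open>F v - f u\<close> against \<open>v 1 - v 0\<close>, whereas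
  monotonicity controls only slopes of \<open>F\<close>.  A monotone flux of \<open>v 0\<close> and \<open>v 1\<close> alone can be compared
  with \<open>F (\<lambda>_. u) = f u\<close> by moving both arguments to \<open>u\<close>, which yields the E condition; further
  variables break this link, and one of them suffices for each counterexample.

  For an E flux that is not monotone, take \<open>f = 0\<close> and a diffusive flux of the right sign whose size
  is switched on by \<open>v 2\<close> (\<open>switched_diffusion_flux\<close>).  The value \<open>u\<^sub>j\<^sub>+\<^sub>2\<close> enters the scheme
  only through the flux at \<open>j + 1/2\<close>, so monotonicity for any \<open>\<sigma>\<close> at all forces \<open>F\<close> to be
  non-increasing in \<open>v 2\<close>
  (\<open>monotone_flux_antimono_rightmost\<close>), and the switch violates this.

  For a monotone flux that is not an E flux, take \<open>f u = u\<close> and a linear flux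
  \<open>\<Sum>i. a i * v i\<close>.  The coefficient of \<open>u\<^sub>j\<^sub>+\<^sub>i\<close> in the scheme is \<open>\<sigma> * (a (i + 1) - a i)\<close>, plus 1
  for \<open>i = 0\<close>.  So the scheme is monotone for small \<open>\<sigma>\<close> as soon as the coefficients do not
  decrease except in the step from \<open>a 0\<close> to \<open>a 1\<close>, which leaves room for a positive \<open>a (-1)\<close>; but then
  the value \<open>u\<^sub>j\<^sub>-\<^sub>1\<close>, unconstrained by the E condition, makes \<open>F\<close> arbitrarily large
  (\<open>wide_linear_flux\<close>).
\<close>

lemma lipschitz_fluxI:
  assumes "L \<ge> 0"
    and bound: "\<And>v w D. (\<And>i. i \<in> stencil k \<Longrightarrow> \<bar>v i - w i\<bar> \<le> D) \<Longrightarrow> \<bar>F v - F w\<bar> \<le> L * D"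
  shows "lipschitz_flux k F"
  unfolding lipschitz_flux_def
proof (intro exI[of _ L] conjI allI)
  fix v w :: "int \<Rightarrow> real"
  have "\<bar>v i - w i\<bar> \<le> L2_set (\<lambda>i. v i - w i) (stencil k)" if "i \<in> stencil k" for i
    using member_le_L2_set[of "stencil k" i "\<lambda>i. \<bar>v i - w i\<bar>"] that
    by (simp add: stencil_def L2_set_def)
  then show "\<bar>F v - F w\<bar> \<le> L * L2_set (\<lambda>i. v i - w i) (stencil k)"
    by (rule bound)
qed (fact assms(1))

lemma at_least_three_pointsI:
  assumes "S \<subseteq> stencil k" "card S = 3" "\<And>i. i \<in> S \<Longrightarrow> depends_on_coord F i"
  shows "at_least_three_points k F"
proof -
  have "card S \<le> card {i \<in> stencil k. depends_on_coord F i}"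
  proof (rule card_mono)
    show "finite {i \<in> stencil k. depends_on_coord F i}"
      by (rule finite_subset[of _ "stencil k"]) (auto simp: stencil_def)
  qed (use assms in auto)
  then show ?thesis
    using assms(2) by (simp add: at_least_three_points_def)
qed

text \<open>
  The flux at \<open>j - 1/2\<close> does not see the rightmost grid value \<open>u\<^sub>j\<^sub>+\<^sub>k\<close>, so that no term can
  compensate for an increase of the flux at \<open>j + 1/2\<close>, however small \<open>\<sigma>\<close> is.  The hypothesis
  \<open>local\<close> expresses that coordinate \<open>k + 1\<close> is outside the stencil.
\<close>

lemma monotone_flux_antimono_rightmost:
  assumes "monotone_flux k F"
    and local: "\<And>v s. F (v(int k + 1 := s)) = F v"
    and "s \<le> t"
    and "k \<ge> 1"
  shows "F (v(int k := t)) \<le> F (v(int k := s))"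
proof -
  obtain \<sigma> where "\<sigma> > 0" and mono: "mono (\<lambda>s. scheme F \<sigma> (v(int k := s)))"
    using assms(1) by (auto simp: monotone_flux_def)
  have shift: "(\<lambda>i. (v(int k := r)) (i - 1)) = (\<lambda>i. v (i - 1))(int k + 1 := r)" for r
    by auto
  have "\<sigma> * F (v(int k := t)) \<le> \<sigma> * F (v(int k := s))"
    using monoD[OF mono \<open>s \<le> t\<close>] \<open>k \<ge> 1\<close>
    by (simp add: scheme_def shift local right_diff_distrib del: fun_upd_apply)
       (simp add: fun_upd_apply)
  then show ?thesis
    using \<open>\<sigma> > 0\<close> by simp
qed

text \<open>
  For \<open>v 0 \<le> v 1\<close> this vanishes; otherwise it is the diffusive flux \<open>v 0 - v 1\<close>, limited to the
  interval from 0 to the positive part of \<open>v 2\<close>.  Taking minimum and maximum instead of a product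
  keeps it globally Lipschitz.
\<close>

definition switched_diffusion_flux :: "(int \<Rightarrow> real) \<Rightarrow> real" where
  "switched_diffusion_flux v = max 0 (min (v 0 - v 1) (v 2))"

lemma consistent_switched_diffusion_flux:
  "consistent_flux 2 (\<lambda>_. 0) switched_diffusion_flux"
proof -
  have "lipschitz_flux 2 switched_diffusion_flux"
  proof (rule lipschitz_fluxI[where L = 2])
    fix v w :: "int \<Rightarrow> real" and D :: real
    assume *: "\<And>i. i \<in> stencil 2 \<Longrightarrow> \<bar>v i - w i\<bar> \<le> D"
    show "\<bar>switched_diffusion_flux v - switched_diffusion_flux w\<bar> \<le> 2 * D"
      using *[of 0] *[of 1] *[of 2]
      by (auto simp: stencil_def switched_diffusion_flux_def)
  qed simp
  then show ?thesis
    by (simp add: consistent_flux_def switched_diffusion_flux_def)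
qed

lemma three_points_switched_diffusion_flux:
  "at_least_three_points 2 switched_diffusion_flux"
proof (rule at_least_three_pointsI[where S = "{0, 1, 2}"])
  fix i :: int
  assume "i \<in> {0, 1, 2}"
  \<comment> \<open>At \<open>v\<close> the limiter is exactly at its threshold: \<open>v 0 - v 1 = v 2 = 1\<close>.\<close>
  let ?v = "(\<lambda>_. 0)(0 := 1, 2 := 1) :: int \<Rightarrow> real"
  have "switched_diffusion_flux (?v(0 := 0)) \<noteq> switched_diffusion_flux (?v(0 := 1))"
    and "switched_diffusion_flux (?v(1 := 1)) \<noteq> switched_diffusion_flux (?v(1 := 0))"
    and "switched_diffusion_flux (?v(2 := 0)) \<noteq> switched_diffusion_flux (?v(2 := 1))"
    by (simp_all add: switched_diffusion_flux_def)
  with \<open>i \<in> {0, 1, 2}\<close> show "depends_on_coord switched_diffusion_flux i"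
    unfolding depends_on_coord_def by blast
qed (auto simp: stencil_def)

lemma E_flux_switched_diffusion_flux: "E_flux (\<lambda>_. 0) switched_diffusion_flux"
  by (auto simp: E_flux_def switched_diffusion_flux_def sgn_if)

lemma not_monotone_switched_diffusion_flux: "\<not> monotone_flux 2 switched_diffusion_flux"
proof
  assume "monotone_flux 2 switched_diffusion_flux"
  from monotone_flux_antimono_rightmost[OF this, of 0 1 "(\<lambda>_. 0)(0 := 1)"]
  show False
    by (simp add: switched_diffusion_flux_def)
qed

definition wide_linear_flux :: "(int \<Rightarrow> real) \<Rightarrow> real" where
  "wide_linear_flux v = v (-1) + v 0 - v 1"

lemma consistent_wide_linear_flux: "consistent_flux 2 (\<lambda>u. u) wide_linear_flux"
proof -
  have "lipschitz_flux 2 wide_linear_flux"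
  proof (rule lipschitz_fluxI[where L = 3])
    fix v w :: "int \<Rightarrow> real" and D :: real
    assume *: "\<And>i. i \<in> stencil 2 \<Longrightarrow> \<bar>v i - w i\<bar> \<le> D"
    show "\<bar>wide_linear_flux v - wide_linear_flux w\<bar> \<le> 3 * D"
      using *[of "-1"] *[of 0] *[of 1]
      by (auto simp: stencil_def wide_linear_flux_def)
  qed simp
  then show ?thesis
    by (simp add: consistent_flux_def wide_linear_flux_def)
qed

lemma three_points_wide_linear_flux: "at_least_three_points 2 wide_linear_flux"
proof (rule at_least_three_pointsI[where S = "{-1, 0, 1}"])
  fix i :: int
  assume "i \<in> {-1, 0, 1}"
  then have "wide_linear_flux ((\<lambda>_. 0)(i := 0)) \<noteq> wide_linear_flux ((\<lambda>_. 0)(i := 1))"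
    by (auto simp: wide_linear_flux_def)
  then show "depends_on_coord wide_linear_flux i"
    unfolding depends_on_coord_def by blast
qed (auto simp: stencil_def)

text \<open>
  The coefficient of \<open>u\<^sub>j\<close> in the scheme is \<open>1 - 2 * \<sigma>\<close>.  At the largest admissible value
  \<open>\<sigma> = 1/2\<close> the scheme reduces to an average of two grid values.
\<close>

lemma monotone_wide_linear_flux: "monotone_flux 2 wide_linear_flux"
proof -
  have average: "scheme wide_linear_flux (1/2) v = (v (-2) + v 1) / 2" for v
    by (simp add: scheme_def wide_linear_flux_def field_simps)
  have "mono (\<lambda>s. scheme wide_linear_flux (1/2) (v(i := s)))" for v i
    unfolding average by (auto simp: mono_def)
  then show ?thesis
    unfolding monotone_flux_def by (intro exI[of _ "1/2"]) auto
qed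

lemma not_E_wide_linear_flux: "\<not> E_flux (\<lambda>u. u) wide_linear_flux"
proof
  assume E: "E_flux (\<lambda>u. u) wide_linear_flux"
  \<comment> \<open>The values jump upwards from 0 to 1, and \<open>v (-1)\<close> lifts the flux to 1, above \<open>f 0 = 0\<close>.\<close>
  define v :: "int \<Rightarrow> real" where "v = (\<lambda>_. 0)(-1 := 2, 1 := 1)"
  have "sgn (v 1 - v 0) * (wide_linear_flux v - v 0) \<le> 0"
    using E by (simp add: E_flux_def)
  then show False
    by (simp add: v_def wide_linear_flux_def)
qed

theorem lemma2p2:
  "(\<exists>(f :: real \<Rightarrow> real) (k :: nat) (F :: (int \<Rightarrow> real) \<Rightarrow> real).
      f C1_differentiable_on UNIV \<and> consistent_flux k f F \<and> at_least_three_points k F \<and>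
      E_flux f F \<and> \<not> monotone_flux k F) \<and>
   (\<exists>(f :: real \<Rightarrow> real) (k :: nat) (F :: (int \<Rightarrow> real) \<Rightarrow> real).
      f C1_differentiable_on UNIV \<and> consistent_flux k f F \<and> at_least_three_points k F \<and>
      monotone_flux k F \<and> \<not> E_flux f F)"
proof (rule conjI; intro exI conjI)
  show "(\<lambda>_. 0 :: real) C1_differentiable_on UNIV" "(\<lambda>u :: real. u) C1_differentiable_on UNIV"
    by simp_all
qed (fact consistent_switched_diffusion_flux three_points_switched_diffusion_flux
      E_flux_switched_diffusion_flux not_monotone_switched_diffusion_flux
      consistent_wide_linear_flux three_points_wide_linear_flux
      monotone_wide_linear_flux not_E_wide_linear_flux)+

end
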